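(* Let $T$ be a forest and let $S\in\Psi(T)$ be a non-empty local maximum stable set of $T$. Then there exists $S_{1}\subset S$ such that $S_{1}\in\Psi(T)$ and $|S_{1}|=|S|-1$.
   Context: Graphs are finite and simple (undirected, no loops, no multiple edges). A forest is an acyclic graph of order greater than $1$ (it need not be connected). A stable set is a set of pairwise non-adjacent vertices. For a graph $G$, $\Omega(G)$ is the set of all stable sets of $G$ of maximum cardinality (maximum stable sets). For $A\subseteq V(G)$, $N(A)=\{v\in V(G)-A : v \text{ is adjacent to some vertex of } A\}$, and $G[X]$ is the subgraph of $G$ induced by $X\subseteq V(G)$. A set $A\subseteq V(G)$ is a local maximum stable set of $G$ if $A\in\Omega(G[A\cup N(A)])$; $\Psi(G)$ denotes the set of all local maximum stable sets of $G$. *)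

theory Defs
  imports "Graph_Theory.Graph_Theory"
begin

text \<open>A finite simple graph is a digraph satisfying the locale predicate \<open>graph\<close> of the entry
  \<open>Graph_Theory\<close>: finite, no loops, no parallel arcs, symmetric; an edge \<open>uv\<close> is a pair of
  opposite arcs.

  In such a digraph the closed walk \<open>u, v, u\<close> along one edge counts as a \<open>cycle\<close>, and the
  library predicate \<open>forest\<close> excludes it too, hence it holds only for edgeless graphs.
  The cycles of the undirected graph are the cycles of length at least 3.\<close>

definition undirected_forest :: "('a, 'b) pre_digraph \<Rightarrow> bool" where
  "undirected_forest G \<longleftrightarrow>
     graph G \<and> \<not> (\<exists>p. pre_digraph.cycle G p \<and> 3 \<le> length p) \<and> 1 < card (verts G)"

definition stable_set :: "('a, 'b) pre_digraph \<Rightarrow> 'a set \<Rightarrow> bool" where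
  "stable_set G A \<longleftrightarrow> A \<subseteq> verts G \<and> (\<forall>u\<in>A. \<forall>v\<in>A. \<not> u \<rightarrow>\<^bsub>G\<^esub> v)"

definition maximum_stable_sets :: "('a, 'b) pre_digraph \<Rightarrow> 'a set set" (\<open>\<Omega>\<close>) where
  "\<Omega> G = {A. stable_set G A \<and> (\<forall>B. stable_set G B \<longrightarrow> card B \<le> card A)}"

definition open_nbhd :: "('a, 'b) pre_digraph \<Rightarrow> 'a set \<Rightarrow> 'a set" where
  "open_nbhd G A = {v \<in> verts G - A. \<exists>u\<in>A. v \<rightarrow>\<^bsub>G\<^esub> u}"

definition local_maximum_stable_sets :: "('a, 'b) pre_digraph \<Rightarrow> 'a set set" (\<open>\<Psi>\<close>) where
  "\<Psi> G = {A. A \<subseteq> verts G \<and> A \<in> \<Omega> (G \<restriction> (A \<union> open_nbhd G A))}"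

end

theory Submission
  imports Defs
begin

text \<open>A forest is used only through one property: every non-empty set \<open>X\<close> of vertices has a member
  with at most one neighbour in \<open>X\<close>. Otherwise a longest path inside \<open>X\<close> could be closed up to a
  cycle of length at least 3 (lemma \<open>graph.ex_degree_le_one\<close>).

  The first consequence is that a non-empty local maximum stable set \<open>S\<close> contains a vertex \<open>v\<close> of
  degree at most one. If every vertex of \<open>S\<close> had two neighbours, then the neighbourhood of \<open>S\<close>
  would contain a stable set larger than \<open>S\<close> (lemma \<open>ex_larger_stable\<close>), contradicting maximality.

  The vertex \<open>v\<close> itself cannot always be dropped: its neighbour may have further neighbours in \<open>S\<close>
  and then survives in the smaller neighbourhood. The vertex to drop is found by induction.
  Delete \<open>v\<close> together with its neighbour, if there is one. The set \<open>S - {v}\<close> is local maximum in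
  what remains, because \<open>v\<close> can be added to any stable set there. By induction some \<open>u\<close> can be
  dropped from \<open>S - {v}\<close> (or \<open>S = {v}\<close>, and then \<open>u = v\<close>). The same \<open>u\<close> can be dropped from \<open>S\<close> in
  the whole forest: a stable set contains at most one of the two deleted vertices, so putting them
  back raises the stability number of the neighbourhood by at most one, which is what putting \<open>v\<close>
  back adds to the cardinality of \<open>S - {v, u}\<close>.\<close>

section \<open>Local maximum stable sets with respect to an adjacency relation\<close>

text \<open>Since the induction deletes vertices, stability and maximality are expressed for one fixed
  adjacency relation and a varying vertex set \<open>V\<close>; deleting vertices then only shrinks \<open>V\<close>.\<close>

locale adjacency =
  fixes adj :: "'a \<Rightarrow> 'a \<Rightarrow> bool"
  assumes adj_sym: "adj x y \<Longrightarrow> adj y x"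
    and adj_irrefl: "\<not> adj x x"
begin

definition stable :: "'a set \<Rightarrow> bool" where
  "stable A \<longleftrightarrow> (\<forall>u\<in>A. \<forall>v\<in>A. \<not> adj u v)"

definition closed_nbhd :: "'a set \<Rightarrow> 'a set \<Rightarrow> 'a set" where
  "closed_nbhd V A = A \<union> {v \<in> V. \<exists>u\<in>A. adj v u}"

definition local_max :: "'a set \<Rightarrow> 'a set \<Rightarrow> bool" where
  "local_max V S \<longleftrightarrow>
     S \<subseteq> V \<and> stable S \<and> (\<forall>I. I \<subseteq> closed_nbhd V S \<longrightarrow> stable I \<longrightarrow> card I \<le> card S)"

definition degree_le_one :: "'a set \<Rightarrow> 'a \<Rightarrow> bool" where
  "degree_le_one X x \<longleftrightarrow> (\<forall>y\<in>X. \<forall>z\<in>X. adj x y \<longrightarrow> adj x z \<longrightarrow> y = z)"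

text \<open>For a finite simple graph this characterises acyclicity: it is 1-degeneracy.\<close>

definition forest_on :: "'a set \<Rightarrow> bool" where
  "forest_on V \<longleftrightarrow> (\<forall>X\<subseteq>V. X \<noteq> {} \<longrightarrow> (\<exists>x\<in>X. degree_le_one X x))"

lemma forest_on_mono: "forest_on V \<Longrightarrow> W \<subseteq> V \<Longrightarrow> forest_on W"
  unfolding forest_on_def by blast

lemma stable_insert:
  assumes "stable I" "\<And>y. y \<in> I \<Longrightarrow> \<not> adj v y"
  shows "stable (insert v I)"
  using assms adj_sym adj_irrefl unfolding stable_def by blast

text \<open>Strip a vertex \<open>x\<close> of degree at most one; by hypothesis it lies outside \<open>A\<close>. If its neighbour
  \<open>y\<close> belongs to \<open>A\<close>, strip \<open>y\<close> as well: this affects no other vertex of \<open>A\<close>, because \<open>A\<close> is stable,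
  and \<open>x\<close> can be added to the stable set found in the remainder, which makes up for the loss of \<open>y\<close>
  in \<open>A\<close>.\<close>

lemma ex_larger_stable:
  assumes "finite X" "X \<noteq> {}" "forest_on X" "A \<subseteq> X" "stable A"
    and "\<And>a. a \<in> A \<Longrightarrow> \<not> degree_le_one X a"
  shows "\<exists>Y. Y \<subseteq> X - A \<and> stable Y \<and> card A < card Y"
  using assms
proof (induction "card X" arbitrary: X A rule: less_induct)
  case less
  obtain x where x: "x \<in> X" "degree_le_one X x"
    using less.prems(2,3) unfolding forest_on_def by blast
  have xA: "x \<notin> A" using less.prems(6) x(2) by blast
  consider (empty) "A = {}" | (outside) "A \<noteq> {}" "\<And>y. y \<in> A \<Longrightarrow> \<not> adj x y"
    | (inside) y where "y \<in> A" "adj x y"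
    by blast
  then show ?case
  proof cases
    case empty
    have "stable {x}" using adj_irrefl unfolding stable_def by blast
    then show ?thesis using empty x by (intro exI[of _ "{x}"]) auto
  next
    case outside
    have smaller: "card (X - {x}) < card X"
      using less.prems(1) x(1) by (rule card_Diff1_less)
    have deg: "\<not> degree_le_one (X - {x}) a" if "a \<in> A" for a
      using less.prems(6)[OF that] outside(2)[OF that] adj_sym
      unfolding degree_le_one_def by blast
    have "finite (X - {x})" "X - {x} \<noteq> {}" "forest_on (X - {x})" "A \<subseteq> X - {x}"
      using forest_on_mono[OF less.prems(3)] less.prems(1,4) xA outside(1) by auto
    from less.hyps[OF smaller this less.prems(5) deg]
    obtain Y where "Y \<subseteq> X - {x} - A" "stable Y" "card A < card Y" by blast
    then show ?thesis by blast
  next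
    case (inside y)
    let ?X = "X - {x, y}" and ?A = "A - {y}"
    have yX: "y \<in> X" using inside less.prems(4) by blast
    have only: "z = y" if "z \<in> X" "adj x z" for z
      using x(2) yX inside(2) that unfolding degree_le_one_def by blast
    have "finite A" using less.prems(1,4) finite_subset by blast
    have smaller: "card ?X < card X"
      using less.prems(1) x(1) by (intro psubset_card_mono) auto
    have deg: "\<not> degree_le_one ?X a" if "a \<in> ?A" for a
    proof -
      have "\<not> adj a y" using less.prems(5) that inside(1) unfolding stable_def by blast
      moreover have "\<not> adj a x" using only[of a] that less.prems(4) adj_sym by blast
      ultimately show ?thesis
        using less.prems(6)[of a] that unfolding degree_le_one_def by blast
    qed
    (* y has a second neighbour, which differs from x and, by irreflexivity, from y *)
    have ne: "?X \<noteq> {}"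
    proof -
      obtain p q where "p \<in> X" "q \<in> X" "adj y p" "adj y q" "p \<noteq> q"
        using less.prems(6)[OF inside(1)] unfolding degree_le_one_def by blast
      moreover have "p \<noteq> y" "q \<noteq> y" using calculation adj_irrefl by blast+
      ultimately show ?thesis by blast
    qed
    have fin: "finite ?X" using less.prems(1) by blast
    have "forest_on ?X" "?A \<subseteq> ?X" "stable ?A"
      using forest_on_mono[OF less.prems(3)] less.prems(4,5) xA
      unfolding stable_def by blast+
    from less.hyps[OF smaller fin ne this deg]
    obtain Y where Y: "Y \<subseteq> ?X - ?A" "stable Y" "card ?A < card Y" by blast
    have "finite Y" using Y(1) less.prems(1) finite_subset by blast
    have "stable (insert x Y)" using stable_insert[OF Y(2)] only Y(1) by blast
    moreover have "insert x Y \<subseteq> X - A" using Y(1) x(1) xA by blast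
    moreover have "card A < card (insert x Y)"
    proof -
      have "x \<notin> Y" using Y(1) by blast
      then show ?thesis
        using Y(3) \<open>finite Y\<close> \<open>finite A\<close> inside(1) card_Suc_Diff1[of A y] by simp
    qed
    ultimately show ?thesis by blast
  qed
qed

lemma local_max_ex_degree_le_one:
  assumes "finite V" "forest_on V" "local_max V S" "S \<noteq> {}"
  shows "\<exists>v\<in>S. degree_le_one V v"
proof (rule ccontr)
  let ?X = "closed_nbhd V S"
  assume none: "\<not> ?thesis"
  have S: "S \<subseteq> V" "stable S" "S \<subseteq> ?X"
    using assms(3) unfolding local_max_def closed_nbhd_def by blast+
  then have X: "?X \<subseteq> V" unfolding closed_nbhd_def by blast
  have deg: "\<not> degree_le_one ?X a" if a: "a \<in> S" for a
  proof -
    obtain y z where "y \<in> V" "z \<in> V" "adj a y" "adj a z" "y \<noteq> z"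
      using none a unfolding degree_le_one_def by blast
    moreover have "y \<in> ?X" "z \<in> ?X"
      using calculation a adj_sym unfolding closed_nbhd_def by blast+
    ultimately show ?thesis unfolding degree_le_one_def by blast
  qed
  have "?X \<noteq> {}" using S(3) assms(4) by blast
  from ex_larger_stable[OF finite_subset[OF X assms(1)] this forest_on_mono[OF assms(2) X]
      S(3,2) deg]
  obtain Y where Y: "Y \<subseteq> ?X - S" "stable Y" "card S < card Y" by blast
  then have "Y \<subseteq> ?X" by blast
  then have "card Y \<le> card S" using assms(3) Y(2) unfolding local_max_def by blast
  then show False using Y(3) by simp
qed

text \<open>The set \<open>W\<close> below, a vertex \<open>v\<close> of \<open>S\<close> and its neighbour, meets every stable set in at most one
  vertex and meets \<open>S\<close> in exactly \<open>v\<close>. Therefore deleting \<open>W\<close> lowers all the cardinalities to be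
  compared in step, and a vertex that can be dropped after the deletion can be dropped before it.\<close>

theorem local_max_remove_vertex:
  assumes "finite V" "forest_on V" "local_max V S" "S \<noteq> {}"
  shows "\<exists>u\<in>S. local_max V (S - {u})"
  using assms
proof (induction "card S" arbitrary: V S rule: less_induct)
  case less
  have SV: "S \<subseteq> V" and S: "stable S"
    and max: "\<And>I. I \<subseteq> closed_nbhd V S \<Longrightarrow> stable I \<Longrightarrow> card I \<le> card S"
    using less.prems(3) unfolding local_max_def by blast+
  have "finite S" using SV less.prems(1) finite_subset by blast
  obtain v where v: "v \<in> S" "degree_le_one V v"
    using local_max_ex_degree_le_one less.prems by blast
  (* W consists of v and its neighbour, or of v alone *)
  define W where "W = insert v {w \<in> V. adj v w}"
  show ?case
  proof (cases "S = {v}")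
    case True
    have "local_max V {}" unfolding local_max_def stable_def closed_nbhd_def by simp
    then show ?thesis using True by simp
  next
    case False
    have SW: "S - W = S - {v}" using S v(1) unfolding W_def stable_def by blast
    have "local_max (V - W) (S - {v})"
      unfolding local_max_def
    proof (intro conjI allI impI)
      show "S - {v} \<subseteq> V - W" using SW SV by blast
      show "stable (S - {v})" using S unfolding stable_def by blast
      fix I assume I: "I \<subseteq> closed_nbhd (V - W) (S - {v})" "stable I"
      have IV: "I \<subseteq> V - W" using I(1) SW SV unfolding closed_nbhd_def by blast
      then have "v \<notin> I" "finite I" using less.prems(1) finite_subset unfolding W_def by blast+
      have "stable (insert v I)" using stable_insert[OF I(2)] IV unfolding W_def by blast
      moreover have "insert v I \<subseteq> closed_nbhd V S"
        using I(1) v(1) unfolding closed_nbhd_def by blast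
      ultimately have "card (insert v I) \<le> card S" using max by blast
      then show "card I \<le> card (S - {v})" using \<open>v \<notin> I\<close> \<open>finite I\<close> v(1) by simp
    qed
    moreover have "card (S - {v}) < card S" using \<open>finite S\<close> v(1) by (rule card_Diff1_less)
    moreover have "S - {v} \<noteq> {}" using False v(1) by blast
    moreover have "forest_on (V - W)" using forest_on_mono[OF less.prems(2)] by blast
    moreover have "finite (V - W)" using less.prems(1) by blast
    ultimately obtain u where u: "u \<in> S - {v}" "local_max (V - W) (S - {v} - {u})"
      using less.hyps[of "S - {v}" "V - W"] by blast
    have "local_max V (S - {u})"
      unfolding local_max_def
    proof (intro conjI allI impI)
      show "S - {u} \<subseteq> V" using SV by blast
      show "stable (S - {u})" using S unfolding stable_def by blast
      fix I assume I: "I \<subseteq> closed_nbhd V (S - {u})" "stable I"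
      have IV: "I \<subseteq> V" using I(1) SV unfolding closed_nbhd_def by blast
      then have "finite I" using less.prems(1) finite_subset by blast
      have "I - W \<subseteq> closed_nbhd (V - W) (S - {v} - {u})"
        using I(1) IV adj_sym unfolding closed_nbhd_def W_def by blast
      moreover have "stable (I - W)" using I(2) unfolding stable_def by blast
      ultimately have outside: "card (I - W) \<le> card (S - {v} - {u})"
        using u(2) unfolding local_max_def by blast
      have "\<forall>a\<in>I \<inter> W. \<forall>b\<in>I \<inter> W. a = b"
        using I(2) v(2) adj_sym unfolding stable_def W_def degree_le_one_def by blast
      then have inside: "card (I \<inter> W) \<le> 1"
        using card_le_Suc0_iff_eq[of "I \<inter> W"] \<open>finite I\<close> by simp
      have "card I = card (I - W) + card (I \<inter> W)"
        using card_Int_Diff[OF \<open>finite I\<close>, of W] by simp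
      moreover have "Suc (card (S - {v} - {u})) = card (S - {u})"
      proof -
        have "S - {v} - {u} = S - {u} - {v}" by blast
        moreover have "finite (S - {u})" "v \<in> S - {u}" using \<open>finite S\<close> v(1) u(1) by auto
        ultimately show ?thesis by (metis card_Suc_Diff1)
      qed
      ultimately show "card I \<le> card (S - {u})" using outside inside by linarith
    qed
    then show ?thesis using u(1) by blast
  qed
qed

end

section \<open>Acyclicity of finite simple graphs\<close>

text \<open>A path in \<open>X\<close> of greatest length cannot be extended at its start \<open>u\<close>, so all neighbours of \<open>u\<close>
  in \<open>X\<close> lie on the path. One of them is not the second vertex of the path, and the edge back from
  it to \<open>u\<close> closes an initial segment with at least two arcs.\<close>

lemma (in graph) ex_degree_le_one:
  assumes acyclic: "\<not> (\<exists>p. cycle p \<and> 3 \<le> length p)"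
    and X: "X \<subseteq> verts G" "X \<noteq> {}"
  shows "\<exists>x\<in>X. \<forall>y\<in>X. \<forall>z\<in>X. x \<rightarrow>\<^bsub>G\<^esub> y \<longrightarrow> x \<rightarrow>\<^bsub>G\<^esub> z \<longrightarrow> y = z"
proof (rule ccontr)
  assume branching: "\<not> ?thesis"
  let ?P = "\<lambda>(u, p, v). apath u p v \<and> set (awalk_verts u p) \<subseteq> X"
  obtain x0 where "x0 \<in> X" using X(2) by blast
  then have "?P (x0, [], x0)" using X(1) by (auto simp: apath_Nil_iff)
  moreover have "\<forall>t. ?P t \<longrightarrow> length (fst (snd t)) < Suc (card (verts G))"
    using length_apath by (auto simp: less_Suc_eq_le apath_def)
  ultimately obtain t where t: "?P t"
      and t_max: "\<And>s. ?P s \<Longrightarrow> length (fst (snd s)) \<le> length (fst (snd t))"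
    using ex_has_greatest_nat[of ?P "(x0, [], x0)" "\<lambda>t. length (fst (snd t))"] by blast
  obtain u p v where uv: "t = (u, p, v)" by (cases t)
  have p: "apath u p v" "set (awalk_verts u p) \<subseteq> X"
    and longest: "\<And>u' p' v'. apath u' p' v' \<Longrightarrow> set (awalk_verts u' p') \<subseteq> X \<Longrightarrow> length p' \<le> length p"
    using t t_max uv by fastforce+
  have "u \<in> X" using p hd_in_awalk_verts[of u p v] by (auto simp: apath_def)
  then obtain y z where yz: "y \<in> X" "z \<in> X" "u \<rightarrow>\<^bsub>G\<^esub> y" "u \<rightarrow>\<^bsub>G\<^esub> z" "y \<noteq> z"
    using branching by blast
  (* for the trivial path the condition on its second vertex is vacuous *)
  obtain w where w: "w \<in> X" "u \<rightarrow>\<^bsub>G\<^esub> w" "p \<noteq> [] \<Longrightarrow> w \<noteq> head G (hd p)"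
    using yz by metis
  have "w \<rightarrow>\<^bsub>G\<^esub> u" by (rule arcs_ends_symmetric[OF sym_arcs w(2)])
  then obtain e where e: "e \<in> arcs G" "tail G e = w" "head G e = u"
    by (auto simp: arcs_ends_conv)
  have "w \<noteq> u" using w(2) adj_not_same by blast
  have w_on: "w \<in> set (awalk_verts u p)"
  proof (rule ccontr)
    assume "w \<notin> set (awalk_verts u p)"
    then have "apath w (e # p) v" using p(1) e by (simp add: apath_Cons_iff)
    moreover have "set (awalk_verts w (e # p)) \<subseteq> X" using p(2) e w(1) by simp
    ultimately show False using longest[of w "e # p" v] by simp
  qed
  obtain q r where q: "p = q @ r" "awalk u q w" "awalk w r v"
    using awalk_decomp[of u p v w] p(1) w_on unfolding apath_def by blast
  have "apath u q (awlast u q)" using p(1) unfolding q(1) apath_append_iff by blast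
  then have "distinct (awalk_verts u q)" by (simp add: apath_def)
  then have "cycle (e # q)"
    using q(2) e unfolding cycle_def by (intro exI[of _ w]) (auto simp: awalk_Cons_iff)
  moreover have "2 \<le> length q"
  proof (rule ccontr)
    assume "\<not> 2 \<le> length q"
    then consider "q = []" | a where "q = [a]"
      by (cases q; cases "tl q") auto
    then show False
    proof cases
      case 1
      then show False using q(2) \<open>w \<noteq> u\<close> by (auto simp: awalk_Nil_iff)
    next
      case 2
      then show False using q(1,2) w(3) by (auto simp: awalk_simps)
    qed
  qed
  ultimately show False using acyclic by fastforce
qed

section \<open>Local maximum stable sets of forests\<close>

context graph
begin

sublocale adjacency "\<lambda>u v. u \<rightarrow>\<^bsub>G\<^esub> v"
proof
  show "x \<rightarrow>\<^bsub>G\<^esub> y \<Longrightarrow> y \<rightarrow>\<^bsub>G\<^esub> x" for x y by (rule arcs_ends_symmetric[OF sym_arcs])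
  show "\<not> x \<rightarrow>\<^bsub>G\<^esub> x" for x using adj_not_same by blast
qed

lemma stable_set_induced:
  "stable_set (G \<restriction> W) A \<longleftrightarrow> A \<subseteq> W \<and> stable A"
  unfolding stable_set_def stable_def by (auto simp: arcs_ends_conv) blast

lemma local_maximum_stable_sets_iff:
  "S \<in> \<Psi> G \<longleftrightarrow> local_max (verts G) S"
proof -
  have "S \<union> open_nbhd G S = closed_nbhd (verts G) S"
    unfolding open_nbhd_def closed_nbhd_def by blast
  then show ?thesis
    unfolding local_maximum_stable_sets_def maximum_stable_sets_def local_max_def
    by (auto simp: stable_set_induced closed_nbhd_def)
qed

end

theorem theorem2p10:
  fixes T :: "('a, 'b) pre_digraph" and S :: "'a set"
  assumes "undirected_forest T"
    and "S \<in> \<Psi> T"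
    and "S \<noteq> {}"
  shows "\<exists>S1. S1 \<subset> S \<and> S1 \<in> \<Psi> T \<and> card S1 = card S - 1"
proof -
  interpret graph T using assms(1) unfolding undirected_forest_def by blast
  have "forest_on (verts T)"
    using ex_degree_le_one assms(1)
    unfolding forest_on_def degree_le_one_def undirected_forest_def by blast
  moreover have "local_max (verts T) S" using assms(2) local_maximum_stable_sets_iff by blast
  ultimately obtain u where u: "u \<in> S" "local_max (verts T) (S - {u})"
    using local_max_remove_vertex assms(3) finite_verts by blast
  then have "S - {u} \<in> \<Psi> T" using local_maximum_stable_sets_iff by blast
  moreover have "S - {u} \<subset> S" "card (S - {u}) = card S - 1" using u(1) by auto
  ultimately show ?thesis by blast
qed

end
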